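(* Let $\mathbb{K}\in\{\mathbb{R},\mathbb{C}\}$, let $B_1,\dots,B_N\in\mathbb{K}^{m\times n}$ and define $$\mathcal{B}:\mathbb{K}^N\otimes\mathbb{K}^n\to\mathbb{K}^m,\qquad x\mapsto\sum_{i=1}^NB_ix_i .$$ Let $A\in\mathbb{K}^{M\times N}$ and let $s,\sigma,t$ be positive integers. Then the hierarchical measurement operator $\mathcal{H}$ defined by $A$ and $(B_i)_{i=1}^N$ satisfies $$\delta_{ts,\sigma}(\mathcal{H})\le\delta_s(A)+\sup_i\delta_\sigma(B_i)+\delta_s(A)\cdot\sup_i\delta_\sigma(B_i)+t\sqrt{s}\cdot\delta_{2s}(A)\cdot\mu_{\mathrm{block}}^{(2\sigma,2\sigma)}(\mathcal{B}).$$
   Context: Let $\|\cdot\|$ be the Euclidean norm. A vector $x\in\mathbb{K}^N\otimes\mathbb{K}^n\cong\mathbb{K}^{Nn}$ with blocks $x_1,\dots,x_N\in\mathbb{K}^n$ is written $x=\sum_{i=1}^Ne_i\otimes x_i$ with $e_i$ the standard basis of $\mathbb{K}^N$. It is $(k,\sigma)$-sparse if at most $k$ of the blocks are non-zero and each non-zero block has at most $\sigma$ non-zero entries. The hierarchical measurement operator defined by $A$ (with columns $a_1,\dots,a_N\in\mathbb{K}^M$) and $(B_i)_{i=1}^N$ is $$\mathcal{H}:\mathbb{K}^N\otimes\mathbb{K}^n\to\mathbb{K}^M\otimes\mathbb{K}^m,\qquad x\mapsto\sum_{i=1}^Na_i\otimes(B_ix_i).$$ For a matrix $B$, $\delta_k(B)$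 is the smallest $\delta\ge0$ with $(1-\delta)\|v\|^2\le\|Bv\|^2\le(1+\delta)\|v\|^2$ for all $k$-sparse $v$ (at most $k$ non-zero entries). $\delta_{k,\sigma}(\mathcal{H})$ is the smallest $\delta\ge0$ with $(1-\delta)\|x\|^2\le\|\mathcal{H}(x)\|^2\le(1+\delta)\|x\|^2$ for all $(k,\sigma)$-sparse $x$. The sparse block-coherence of $\mathcal{B}$ at sparsity level $2\sigma$ is $$\mu_{\mathrm{block}}^{(2\sigma,2\sigma)}(\mathcal{B})=\sup_{i\ne j}\ \sup\{|\langle u,B_i^*B_jv\rangle| : u,v\in\mathbb{K}^n\ 2\sigma\text{-sparse},\ \|u\|=\|v\|=1\},$$ with the supremum over an empty index set being $0$. *)

theory Defs
  imports "HOL-Analysis.Analysis"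
begin

text \<open>A vector with \<open>N\<close> blocks in \<open>K^n\<close> has type \<^typ>\<open>'a^'n^'N\<close>; its norm is then the
  Euclidean norm of all entries. The matrices with \<open>m\<close> rows and \<open>n\<close> columns have type
  \<^typ>\<open>'a^'n^'m\<close>.\<close>

text \<open>The class only serves to treat conjugation on the reals (the identity) and on the complex
  numbers uniformly. The axioms force the elements fixed by \<open>conjugate\<close> to be the scalars
  \<open>of_real r\<close>, so up to isomorphism there are no further instances.\<close>

class conjugation = real_normed_field +
  fixes conjugate :: "'a \<Rightarrow> 'a"
  assumes conjugate_add: "conjugate (x + y) = conjugate x + conjugate y"
    and conjugate_mult: "conjugate (x * y) = conjugate x * conjugate y"
    and mult_conjugate: "x * conjugate x = (norm x)\<^sup>2 *\<^sub>R 1"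

instantiation real :: conjugation
begin
definition conjugate_real :: "real \<Rightarrow> real" where "conjugate_real x = x"
instance by standard (simp_all add: conjugate_real_def power2_eq_square)
end

instantiation complex :: conjugation
begin
definition conjugate_complex :: "complex \<Rightarrow> complex" where "conjugate_complex = cnj"
instance
  by standard (simp_all add: conjugate_complex_def complex_norm_square[symmetric] scaleR_conv_of_real flip: of_real_power)
end

definition field_inner :: "'a::conjugation^'n \<Rightarrow> 'a^'n \<Rightarrow> 'a" where
  "field_inner u v = (\<Sum>i\<in>UNIV. conjugate (u $ i) * v $ i)"

definition conj_transpose :: "'a::conjugation^'n^'m \<Rightarrow> 'a^'m^'n" where
  "conj_transpose B = (\<chi> i j. conjugate (B $ j $ i))"

definition sparse :: "nat \<Rightarrow> 'a::zero^'n \<Rightarrow> bool" where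
  "sparse k v \<longleftrightarrow> card {i. v $ i \<noteq> 0} \<le> k"

definition hier_sparse :: "nat \<Rightarrow> nat \<Rightarrow> 'a::zero^'n^'N \<Rightarrow> bool" where
  "hier_sparse k \<sigma> x \<longleftrightarrow>
     card {i. x $ i \<noteq> 0} \<le> k \<and> (\<forall>i. x $ i \<noteq> 0 \<longrightarrow> sparse \<sigma> (x $ i))"

definition tensor_vec :: "'a::semiring_1^'M \<Rightarrow> 'a^'m \<Rightarrow> 'a^'m^'M" where
  "tensor_vec a y = (\<chi> p. a $ p *s y)"

definition hier_op :: "'a::semiring_1^'N^'M \<Rightarrow> ('N \<Rightarrow> 'a^'n^'m) \<Rightarrow> 'a^'n^'N \<Rightarrow> 'a^'m^'M" where
  "hier_op A B x = (\<Sum>i\<in>UNIV. tensor_vec (column i A) (B i *v (x $ i)))"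

definition block_op :: "('N \<Rightarrow> 'a::semiring_1^'n^'m) \<Rightarrow> 'a^'n^'N \<Rightarrow> 'a^'m" where
  "block_op B x = (\<Sum>i\<in>UNIV. B i *v (x $ i))"

definition isometry_const ::
    "'v::real_normed_vector set \<Rightarrow> ('v \<Rightarrow> 'w::real_normed_vector) \<Rightarrow> real" where
  "isometry_const S f = (LEAST \<delta>. 0 \<le> \<delta> \<and>
     (\<forall>v\<in>S. (1 - \<delta>) * (norm v)\<^sup>2 \<le> (norm (f v))\<^sup>2 \<and>
            (norm (f v))\<^sup>2 \<le> (1 + \<delta>) * (norm v)\<^sup>2))"

definition rip_const :: "nat \<Rightarrow> 'a::real_normed_field^'n^'m \<Rightarrow> real" where
  "rip_const k B = isometry_const {v. sparse k v} (\<lambda>v. B *v v)"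

definition hier_rip_const ::
    "nat \<Rightarrow> nat \<Rightarrow> ('a::real_normed_field^'n^'N \<Rightarrow> 'a^'m^'M) \<Rightarrow> real" where
  "hier_rip_const k \<sigma> H = isometry_const {x. hier_sparse k \<sigma> x} H"

text \<open>On the reals, \<open>Sup {}\<close> is an unspecified value.\<close>

definition Sup0 :: "real set \<Rightarrow> real" where
  "Sup0 S = (if S = {} then 0 else Sup S)"

text \<open>The matrix \<open>B\<^sub>i\<close> is recovered from the operator: it represents \<open>v \<mapsto> F (e\<^sub>i \<otimes> v)\<close>, where
  \<open>e\<^sub>i \<otimes> v\<close> is \<open>axis i v\<close>.\<close>

definition block :: "('a::semiring_1^'n^'N \<Rightarrow> 'a^'m) \<Rightarrow> 'N \<Rightarrow> 'a^'n^'m" where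
  "block F i = matrix (\<lambda>v. F (axis i v))"

lemma block_block_op: "block (block_op B) i = B i"
proof -
  have "block_op B (axis i v) = B i *v v" for v
  proof -
    have "block_op B (axis i v) = (\<Sum>k\<in>UNIV. if k = i then B i *v v else 0)"
      unfolding block_op_def by (rule sum.cong) (auto simp: axis_def)
    then show ?thesis by simp
  qed
  then have *: "block (block_op B) i = matrix (\<lambda>v. B i *v v)"
    by (simp add: block_def)
  have "B i *v axis j 1 = column j (B i)" for j
    by (simp add: matrix_vector_mult_def axis_def column_def if_distrib cong: if_cong)
  then show ?thesis
    unfolding * by (simp add: matrix_def vec_eq_iff column_def)
qed

definition block_coherence ::
    "nat \<Rightarrow> nat \<Rightarrow> ('a::conjugation^'n^'N \<Rightarrow> 'a^'m) \<Rightarrow> real" where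
  "block_coherence k l F =
     Sup0 {Sup0 {norm (field_inner u ((conj_transpose (block F i) ** block F j) *v v)) | u v.
                   sparse k u \<and> sparse l v \<and> norm u = 1 \<and> norm v = 1} | i j. i \<noteq> j}"

text \<open>The least constants exist, so \<^const>\<open>rip_const\<close> and \<^const>\<open>hier_rip_const\<close> are meaningful.\<close>

lemma isometry_const_least:
  fixes f :: "'v::real_normed_vector \<Rightarrow> 'w::real_normed_vector"
    and S :: "'v set"
  assumes bound: "\<And>v. norm (f v) \<le> C * norm v"
  defines "P \<equiv> \<lambda>\<delta>. 0 \<le> \<delta> \<and> (\<forall>v\<in>S. (1 - \<delta>) * (norm v)\<^sup>2 \<le> (norm (f v))\<^sup>2 \<and>
            (norm (f v))\<^sup>2 \<le> (1 + \<delta>) * (norm v)\<^sup>2)"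
  shows "P (isometry_const S f)" and "P \<delta> \<Longrightarrow> isometry_const S f \<le> \<delta>"
proof -
  have "(norm (f v))\<^sup>2 \<le> C\<^sup>2 * (norm v)\<^sup>2" for v
    using power_mono[OF bound[of v], of 2] by (simp add: power_mult_distrib)
  moreover have "C\<^sup>2 * (norm v)\<^sup>2 \<le> (1 + (1 + C\<^sup>2)) * (norm v)\<^sup>2" for v :: 'v
    by (rule mult_right_mono) auto
  moreover have "(1 - (1 + C\<^sup>2)) * (norm v)\<^sup>2 \<le> (norm (f v))\<^sup>2" for v :: 'v
    by (rule order_trans[of _ 0]) auto
  moreover have "(1 - (1 + C\<^sup>2)) * r \<ge> (1 - (2 + C\<^sup>2)) * r" if "r \<ge> 0" for r :: real
    using that by (intro mult_right_mono) auto
  ultimately have ne: "P (1 + C\<^sup>2)"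
    unfolding P_def by (auto intro: order_trans)
  have bdd: "bdd_below (Collect P)"
    by (rule bdd_belowI[of _ 0]) (simp add: P_def)
  have "closed (Collect P)"
    unfolding P_def Ball_def
    by (intro closed_Collect_conj closed_Collect_all closed_Collect_imp
        closed_Collect_le open_Collect_const continuous_intros)
  then have "P (Inf (Collect P))"
    using closed_contains_Inf[of "Collect P"] ne bdd by auto
  moreover have "Inf (Collect P) \<le> y" if "P y" for y
    using that bdd by (auto intro: cInf_lower)
  moreover have "isometry_const S f = (LEAST \<delta>. P \<delta>)"
    by (simp add: isometry_const_def P_def)
  ultimately show "P (isometry_const S f)" and "P \<delta> \<Longrightarrow> isometry_const S f \<le> \<delta>"
    by (auto intro: LeastI2_order Least_le simp: Least_equality)
qed

end

theory Submission imports Defs begin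

text \<open>Write \<open>y\<^sub>i = B\<^sub>i x\<^sub>i\<close>. Then \<open>\<parallel>H x\<parallel>\<^sup>2 = \<Sum>\<^sub>i\<^sub>j \<langle>a\<^sub>i, a\<^sub>j\<rangle> \<langle>y\<^sub>i, y\<^sub>j\<rangle>\<close>. The diagonal terms
  lie between \<open>(1 - \<delta>\<^sub>s(A)) (1 - \<delta>\<^sub>\<sigma>(B\<^sub>i)) \<parallel>x\<^sub>i\<parallel>\<^sup>2\<close> and
  \<open>(1 + \<delta>\<^sub>s(A)) (1 + \<delta>\<^sub>\<sigma>(B\<^sub>i)) \<parallel>x\<^sub>i\<parallel>\<^sup>2\<close>. In the off-diagonal terms \<open>\<langle>y\<^sub>i, y\<^sub>j\<rangle>\<close> is controlled by the
  coherence, and what remains is the quadratic form of the matrix \<open>\<bar>\<langle>a\<^sub>i, a\<^sub>j\<rangle>\<bar>\<close> without its diagonal,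
  restricted to the at most \<open>t s\<close> non-zero blocks. Polarisation shows that a row of this matrix,
  restricted to \<open>s\<close> columns, has Euclidean norm at most \<open>\<delta>\<^sub>2\<^sub>s(A)\<close>; hence a full row has norm at
  most \<open>\<surd>t \<delta>\<^sub>2\<^sub>s(A)\<close>, and the Frobenius norm is at most
  \<open>\<surd>(t s) \<surd>t \<delta>\<^sub>2\<^sub>s(A) = t \<surd>s \<delta>\<^sub>2\<^sub>s(A)\<close>.\<close>

section \<open>Conjugation and the sesquilinear form\<close>

lemma conjugate_0 [simp]: "conjugate (0::'a::conjugation) = 0"
  using conjugate_add[of "0::'a" 0] by simp

lemma conjugate_sum: "conjugate (sum f I) = (\<Sum>i\<in>I. conjugate (f i :: 'a::conjugation))"
  by (induction I rule: infinite_finite_induct) (simp_all add: conjugate_add)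

text \<open>Norms are multiplicative, so taking norms in \<open>mult_conjugate\<close> leaves only a
  factor \<open>norm x\<close> to cancel.\<close>

lemma norm_conjugate [simp]: "norm (conjugate (x::'a::conjugation)) = norm x"
proof (cases "x = 0")
  case False
  have "norm x * norm (conjugate x) = norm x * norm x"
    using arg_cong[OF mult_conjugate[of x], of norm]
    by (simp add: norm_mult power2_eq_square)
  with False show ?thesis by simp
qed simp

text \<open>Since \<open>x\<close> and \<open>conjugate x\<close> have equal norms,
  \<open>mult_conjugate\<close> gives each the same product with its conjugate, and the common
  factor \<open>conjugate x\<close> cancels.\<close>

lemma conjugate_conjugate [simp]: "conjugate (conjugate (x::'a::conjugation)) = x"
proof (cases "x = 0")
  case False
  have "conjugate x * conjugate (conjugate x) = conjugate x * x"
    using mult_conjugate[of x] mult_conjugate[of "conjugate x"] by (simp add: mult.commute)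
  moreover have "conjugate x \<noteq> 0"
    using False norm_conjugate[of x] by (metis norm_eq_zero)
  ultimately show ?thesis by simp
qed simp

lemma conjugate_mult_self: "conjugate x * x = of_real ((norm (x::'a::conjugation))\<^sup>2)"
  using mult_conjugate[of x] by (simp only: of_real_def mult.commute)

lemma conjugate_of_real [simp]: "conjugate (of_real r :: 'a::conjugation) = of_real r"
proof (cases "r = 0")
  case False
  have "(of_real r :: 'a) * conjugate (of_real r) = of_real r * of_real r"
    using mult_conjugate[of "of_real r :: 'a"]
    by (simp add: power2_eq_square of_real_def)
  with False show ?thesis by simp
qed simp

lemma norm_vec_square: "(norm x)\<^sup>2 = (\<Sum>i\<in>UNIV. (norm ((x::'a::real_normed_vector^'n) $ i))\<^sup>2)"
  by (simp add: norm_vec_def L2_set_def sum_nonneg)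

lemma field_inner_self: "field_inner u u = of_real ((norm (u::'a::conjugation^'n))\<^sup>2)"
  by (simp add: field_inner_def conjugate_mult_self norm_vec_square)

lemma field_inner_add_left: "field_inner (u + v) w = field_inner u w + field_inner v w"
  by (simp add: field_inner_def conjugate_add distrib_right sum.distrib)

lemma field_inner_add_right: "field_inner w (u + v) = field_inner w u + field_inner w v"
  by (simp add: field_inner_def distrib_left sum.distrib)

lemma field_inner_scale_left: "field_inner (c *s u) w = conjugate c * field_inner u w"
  by (simp add: field_inner_def conjugate_mult sum_distrib_left mult_ac)

lemma field_inner_scale_right: "field_inner w (c *s u) = c * field_inner w u"
  by (simp add: field_inner_def sum_distrib_left mult_ac)

lemma field_inner_minus_right: "field_inner w (- u) = - field_inner w u"
  by (simp add: field_inner_def sum_negf)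

lemma field_inner_sum_left: "field_inner (\<Sum>i\<in>I. f i) w = (\<Sum>i\<in>I. field_inner (f i) w)"
  by (simp add: field_inner_def conjugate_sum sum_distrib_right) (rule sum.swap)

lemma field_inner_sum_right: "field_inner w (\<Sum>i\<in>I. f i) = (\<Sum>i\<in>I. field_inner w (f i))"
  by (simp add: field_inner_def sum_distrib_left) (rule sum.swap)

lemma field_inner_commute: "field_inner v u = conjugate (field_inner u v)"
  by (simp add: field_inner_def conjugate_sum conjugate_mult mult.commute)

lemma field_inner_0 [simp]: "field_inner 0 u = 0" "field_inner u 0 = 0"
  by (simp_all add: field_inner_def)

lemma norm_field_inner_le: "norm (field_inner u v) \<le> norm u * norm v"
proof -
  have "norm (field_inner u v) \<le> (\<Sum>i\<in>UNIV. norm (u $ i) * norm (v $ i))"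
    unfolding field_inner_def by (rule order_trans[OF norm_sum]) (simp add: norm_mult)
  also have "\<dots> \<le> norm u * norm v"
    unfolding norm_vec_def using L2_set_mult_ineq[of "\<lambda>i. norm (u $ i)" "\<lambda>i. norm (v $ i)" UNIV]
    by simp
  finally show ?thesis .
qed

text \<open>Turns the form defining the coherence into an inner product of the images
  \<open>B i *v u\<close> and \<open>B j *v v\<close>.\<close>

lemma field_inner_adjoint:
  "field_inner u (conj_transpose B *v w) = field_inner (B *v u) w"
proof -
  have "field_inner u (conj_transpose B *v w)
      = (\<Sum>i\<in>UNIV. \<Sum>j\<in>UNIV. conjugate (u $ i) * (conjugate (B $ j $ i) * w $ j))"
    by (simp add: field_inner_def conj_transpose_def matrix_vector_mult_def sum_distrib_left)
  also have "\<dots> = (\<Sum>j\<in>UNIV. \<Sum>i\<in>UNIV. conjugate (u $ i) * (conjugate (B $ j $ i) * w $ j))"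
    by (rule sum.swap)
  also have "\<dots> = field_inner (B *v u) w"
    by (simp add: field_inner_def matrix_vector_mult_def conjugate_sum conjugate_mult
        sum_distrib_left sum_distrib_right mult_ac)
  finally show ?thesis .
qed

text \<open>A real inner product is fixed by conjugation, so both cross terms equal
  \<open>c\<close>. The form of the hypothesis replaces taking a real part, an operation that
  \<open>conjugation\<close> does not provide.\<close>

lemma norm_add_square_field_inner:
  assumes "field_inner u v = of_real c"
  shows "(norm (u + v))\<^sup>2 = (norm u)\<^sup>2 + (norm v)\<^sup>2 + 2 * c"
proof -
  have vu: "field_inner v u = of_real c"
    using assms field_inner_commute[of v u] by simp
  have "of_real ((norm (u + v))\<^sup>2) = (of_real ((norm u)\<^sup>2 + (norm v)\<^sup>2 + 2 * c) :: 'a)"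
    unfolding field_inner_self[of "u + v", symmetric]
    by (simp add: field_inner_add_left field_inner_add_right assms vu field_inner_self[of u] field_inner_self[of v])
  then show ?thesis by (simp only: of_real_eq_iff)
qed

lemma norm_diff_square_field_inner:
  assumes "field_inner u v = of_real c"
  shows "(norm (u - v))\<^sup>2 = (norm u)\<^sup>2 + (norm v)\<^sup>2 - 2 * c"
  using norm_add_square_field_inner[of u "- v" "- c"] assms
  by (simp add: field_inner_minus_right)

section \<open>Restricted isometry constants\<close>

lemma norm_vector_smult: "norm (c *s (v::'a::real_normed_field^'n)) = norm c * norm v"
  by (simp add: norm_vec_def norm_mult L2_set_right_distrib)

text \<open>A crude bound: it supplies the boundedness under which
  \<open>isometry_const_least\<close> applies, and later bounds the sets behind the
  coherence.\<close>

lemma norm_matrix_vector_mult_le: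
  fixes B :: "'a::real_normed_field^'n^'m"
  shows "norm (B *v v) \<le> (\<Sum>i\<in>UNIV. \<Sum>j\<in>UNIV. norm (B $ i $ j)) * norm v"
proof -
  have "norm (B *v v) \<le> (\<Sum>i\<in>UNIV. norm ((B *v v) $ i))"
    unfolding norm_vec_def by (rule L2_set_le_sum) simp
  also have "\<dots> \<le> (\<Sum>i\<in>UNIV. \<Sum>j\<in>UNIV. norm (B $ i $ j) * norm v)"
    unfolding matrix_vector_mult_def
    by (auto intro!: sum_mono order_trans[OF norm_sum] mult_left_mono Finite_Cartesian_Product.norm_nth_le
        simp: norm_mult)
  finally show ?thesis by (simp add: sum_distrib_right)
qed

lemma rip_const_nonneg: "0 \<le> rip_const k (B :: 'a::real_normed_field^'n^'m)"
  unfolding rip_const_def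
  using isometry_const_least(1)[OF norm_matrix_vector_mult_le[of B]] by blast

lemma rip_const_lower:
  fixes B :: "'a::real_normed_field^'n^'m"
  assumes "sparse k v"
  shows "(1 - rip_const k B) * (norm v)\<^sup>2 \<le> (norm (B *v v))\<^sup>2"
  unfolding rip_const_def
  using isometry_const_least(1)[OF norm_matrix_vector_mult_le[of B], of "{v. sparse k v}"] assms
  by blast

lemma rip_const_upper:
  fixes B :: "'a::real_normed_field^'n^'m"
  assumes "sparse k v"
  shows "(norm (B *v v))\<^sup>2 \<le> (1 + rip_const k B) * (norm v)\<^sup>2"
  unfolding rip_const_def
  using isometry_const_least(1)[OF norm_matrix_vector_mult_le[of B], of "{v. sparse k v}"] assms
  by blast

lemma sparse_support:
  assumes "\<And>i. v $ i \<noteq> 0 \<Longrightarrow> i \<in> S" "card S \<le> k"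
  shows "sparse k v"
proof -
  have "{i. v $ i \<noteq> 0} \<subseteq> S" using assms(1) by blast
  then have "card {i. v $ i \<noteq> 0} \<le> card S" by (intro card_mono) auto
  with \<open>card S \<le> k\<close> show ?thesis unfolding sparse_def by linarith
qed

section \<open>Columns of a matrix and their Gram matrix\<close>

lemma matrix_vector_mult_axis:
  "(A :: 'a::comm_semiring_1^'N^'M) *v axis i c = c *s column i A"
  by (simp add: vec_eq_iff matrix_vector_mult_def axis_def column_def if_distrib mult.commute
      cong: if_cong)

lemma matrix_vector_mult_columns:
  "(A :: 'a::comm_semiring_1^'N^'M) *v w = (\<Sum>j\<in>UNIV. w $ j *s column j A)"
  by (simp add: vec_eq_iff matrix_vector_mult_def column_def mult.commute)

lemma norm_axis_scalar: "norm (axis i c :: 'a::real_normed_vector^'N) = norm c"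
proof -
  have "(norm (axis i c :: 'a^'N))\<^sup>2 = (\<Sum>j\<in>UNIV. if j = i then (norm c)\<^sup>2 else 0)"
    unfolding norm_vec_square by (rule sum.cong) (auto simp: axis_def)
  then show ?thesis by simp
qed

lemma norm_column_rip:
  fixes A :: "'a::real_normed_field^'N^'M"
  assumes "s > 0"
  shows "1 - rip_const s A \<le> (norm (column i A))\<^sup>2"
    and "(norm (column i A))\<^sup>2 \<le> 1 + rip_const s A"
proof -
  \<comment> \<open>A standard basis vector is a legitimate test vector because \<open>s\<close> is
    at least 1.\<close>
  have "sparse s (axis i 1 :: 'a^'N)"
    by (rule sparse_support[where S = "{i}"]) (use assms in \<open>auto simp: axis_def split: if_splits\<close>)
  from rip_const_lower[OF this, of A] rip_const_upper[OF this, of A]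
  show "1 - rip_const s A \<le> (norm (column i A))\<^sup>2"
    and "(norm (column i A))\<^sup>2 \<le> 1 + rip_const s A"
    by (simp_all add: matrix_vector_mult_axis norm_axis_scalar)
qed

text \<open>Polarisation with two orthogonal vectors \<open>u\<close> and \<open>w\<close> of norm
  \<open>r\<close>, the norm of the row: \<open>A *v u\<close> and \<open>A *v w\<close> have inner
  product \<open>r ^ 3\<close>, whereas the isometry bounds on \<open>u + w\<close> and
  \<open>u - w\<close> allow at most \<open>rip_const (2 * s) A * r\<^sup>2\<close>.\<close>

lemma gram_row_le:
  fixes A :: "'a::conjugation^'N^'M"
  assumes "s > 0" and S: "card S \<le> s" "i \<notin> S"
  shows "(\<Sum>j\<in>S. (norm (field_inner (column i A) (column j A)))\<^sup>2) \<le> (rip_const (2 * s) A)\<^sup>2"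
proof -
  let ?g = "\<lambda>j. field_inner (column j A) (column i A)"
  define r where "r = sqrt (\<Sum>j\<in>S. (norm (?g j))\<^sup>2)"
  \<comment> \<open>The entries are the conjugates of the row entries, so that pairing
    \<open>column i A\<close> with \<open>A *v w\<close> gives a sum of squared absolute values, in
    particular a real number.\<close>
  define w :: "'a^'N" where "w = (\<chi> j. if j \<in> S then ?g j else 0)"
  define u :: "'a^'N" where "u = axis i (of_real r)"
  have r0: "r \<ge> 0" by (simp add: r_def sum_nonneg)
  have r2: "r\<^sup>2 = (\<Sum>j\<in>S. (norm (?g j))\<^sup>2)" by (simp add: r_def sum_nonneg)
  have Au: "A *v u = of_real r *s column i A"
    by (simp add: u_def matrix_vector_mult_axis)
  have "field_inner (column i A) (A *v w)
      = (\<Sum>j\<in>UNIV. if j \<in> S then ?g j * field_inner (column i A) (column j A) else 0)"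
    unfolding matrix_vector_mult_columns field_inner_sum_right field_inner_scale_right
    by (rule sum.cong) (auto simp: w_def)
  also have "\<dots> = (\<Sum>j\<in>S. ?g j * field_inner (column i A) (column j A))"
    by (simp add: sum.If_cases)
  also have "\<dots> = (\<Sum>j\<in>S. of_real ((norm (?g j))\<^sup>2))"
  proof (rule sum.cong)
    fix j
    show "?g j * field_inner (column i A) (column j A) = of_real ((norm (?g j))\<^sup>2)"
      using conjugate_mult_self[of "?g j"] field_inner_commute[of "column i A" "column j A"]
      by (simp add: mult.commute)
  qed simp
  finally have "field_inner (A *v u) (A *v w) = of_real (r * r\<^sup>2)"
    by (simp add: Au field_inner_scale_left r2)
  note A_add = norm_add_square_field_inner[OF this] and A_diff = norm_diff_square_field_inner[OF this]
  have "field_inner u w = of_real 0"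
    unfolding field_inner_def of_real_0
    by (rule sum.neutral) (use S in \<open>auto simp: u_def w_def axis_def\<close>)
  note uw_add = norm_add_square_field_inner[OF this] and uw_diff = norm_diff_square_field_inner[OF this]
  have nu: "(norm u)\<^sup>2 = r\<^sup>2"
    by (simp add: u_def norm_axis_scalar)
  have "(norm w)\<^sup>2 = (\<Sum>j\<in>UNIV. if j \<in> S then (norm (?g j))\<^sup>2 else 0)"
    unfolding norm_vec_square by (rule sum.cong) (auto simp: w_def)
  then have nw: "(norm w)\<^sup>2 = r\<^sup>2"
    by (simp add: r2 sum.If_cases)
  \<comment> \<open>This is s + 1 \<le> 2s, where \<open>s > 0\<close> enters.\<close>
  have card: "card (insert i S) \<le> 2 * s"
    using S \<open>s > 0\<close> by (simp add: card_insert_if)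
  have "sparse (2 * s) (u + w)"
    by (rule sparse_support[OF _ card]) (auto simp: u_def w_def axis_def split: if_splits)
  from rip_const_upper[OF this, of A]
  have 1: "(norm (A *v (u + w)))\<^sup>2 \<le> (1 + rip_const (2 * s) A) * (2 * r\<^sup>2)"
    by (simp add: uw_add nu nw)
  have "sparse (2 * s) (u - w)"
    by (rule sparse_support[OF _ card]) (auto simp: u_def w_def axis_def split: if_splits)
  from rip_const_lower[OF this, of A]
  have 2: "(1 - rip_const (2 * s) A) * (2 * r\<^sup>2) \<le> (norm (A *v (u - w)))\<^sup>2"
    by (simp add: uw_diff nu nw)
  have "4 * (r * r\<^sup>2) = (norm (A *v (u + w)))\<^sup>2 - (norm (A *v (u - w)))\<^sup>2"
    by (simp add: matrix_vector_right_distrib matrix_vector_mult_diff_distrib A_add A_diff)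
  also have "\<dots> \<le> 4 * (rip_const (2 * s) A * r\<^sup>2)"
    using 1 2 by (simp add: algebra_simps)
  finally have *: "r * r\<^sup>2 \<le> rip_const (2 * s) A * r\<^sup>2" by simp
  have "r \<le> rip_const (2 * s) A"
  proof (cases "r = 0")
    case True
    then show ?thesis by (simp add: rip_const_nonneg)
  next
    case False
    then have "r\<^sup>2 > 0" by simp
    then show ?thesis using * mult_le_cancel_right_pos by blast
  qed
  then have "r\<^sup>2 \<le> (rip_const (2 * s) A)\<^sup>2"
    using r0 by (rule power_mono)
  moreover have "norm (?g j) = norm (field_inner (column i A) (column j A))" for j
    by (subst field_inner_commute) simp
  ultimately show ?thesis by (simp add: r2)
qed

text \<open>\<open>T\<close> splits into \<open>t\<close> pieces of at most \<open>s\<close>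
  elements each; the induction removes one piece at a time.\<close>

lemma sum_le_of_card_mult:
  fixes f :: "'i \<Rightarrow> real"
  assumes "\<And>S. S \<subseteq> T \<Longrightarrow> card S \<le> s \<Longrightarrow> sum f S \<le> c"
    and "finite T" "card T \<le> t * s"
  shows "sum f T \<le> real t * c"
  using assms
proof (induction t arbitrary: T)
  case 0
  then show ?case by simp
next
  case (Suc t)
  \<comment> \<open>The minimum covers a set with fewer than \<open>s\<close> elements left, which
    is then removed entirely.\<close>
  obtain S where S: "S \<subseteq> T" "card S = min s (card T)"
    using obtain_subset_with_card_n[of "min s (card T)" T] by auto
  have "finite S" using S Suc.prems(2) finite_subset by blast
  then have "card (T - S) = card T - card S"
    using S by (intro card_Diff_subset)
  then have "card (T - S) \<le> t * s"
    using S(2) Suc.prems(3) by simp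
  then have "sum f (T - S) \<le> real t * c"
    using Suc.prems by (intro Suc.IH) auto
  moreover have "sum f S \<le> c"
    using S by (intro Suc.prems) auto
  moreover have "sum f T = sum f (T - S) + sum f S"
    using S Suc.prems by (intro sum.subset_diff)
  ultimately show ?case by (simp add: algebra_simps)
qed

text \<open>Two applications of Cauchy-Schwarz: along each row, and then to the sum of the
  \<open>\<bar>y i\<bar>\<close> against the constant 1.\<close>

lemma gram_offdiagonal_form_le:
  fixes A :: "'a::conjugation^'N^'M" and y :: "'N \<Rightarrow> real"
  assumes "s > 0" and T: "card T \<le> t * s"
  shows "(\<Sum>i\<in>T. \<Sum>j\<in>T - {i}. norm (field_inner (column i A) (column j A)) * (\<bar>y i\<bar> * \<bar>y j\<bar>))
      \<le> real t * sqrt (real s) * rip_const (2 * s) A * (\<Sum>i\<in>T. (y i)\<^sup>2)"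
proof -
  let ?g = "\<lambda>i j. norm (field_inner (column i A) (column j A))"
  let ?\<delta> = "rip_const (2 * s) A"
  let ?Y = "L2_set y T"
  have row: "L2_set (?g i) (T - {i}) \<le> sqrt (real t) * ?\<delta>" if "i \<in> T" for i
  proof -
    have "(\<Sum>j\<in>T - {i}. (?g i j)\<^sup>2) \<le> real t * ?\<delta>\<^sup>2"
    proof (rule sum_le_of_card_mult[where s = s])
      show "(\<Sum>j\<in>S. (?g i j)\<^sup>2) \<le> ?\<delta>\<^sup>2" if "S \<subseteq> T - {i}" "card S \<le> s" for S
        using that \<open>s > 0\<close> by (intro gram_row_le) auto
      show "card (T - {i}) \<le> t * s"
        using T card_Diff1_le[of T i] by linarith
    qed simp
    then have "L2_set (?g i) (T - {i}) \<le> sqrt (real t * ?\<delta>\<^sup>2)"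
      unfolding L2_set_def by (rule real_sqrt_le_mono)
    then show ?thesis
      by (simp add: real_sqrt_mult rip_const_nonneg)
  qed
  have inner: "(\<Sum>j\<in>T - {i}. ?g i j * (\<bar>y i\<bar> * \<bar>y j\<bar>)) \<le> \<bar>y i\<bar> * (sqrt (real t) * ?\<delta> * ?Y)"
    if "i \<in> T" for i
  proof -
    have "(\<Sum>j\<in>T - {i}. ?g i j * \<bar>y j\<bar>) \<le> L2_set (?g i) (T - {i}) * L2_set y (T - {i})"
      using L2_set_mult_ineq[of "?g i" y "T - {i}"] by simp
    also have "\<dots> \<le> sqrt (real t) * ?\<delta> * ?Y"
      by (intro mult_mono row that)
        (auto simp: L2_set_def rip_const_nonneg sum_nonneg intro!: sum_mono2)
    finally have "\<bar>y i\<bar> * (\<Sum>j\<in>T - {i}. ?g i j * \<bar>y j\<bar>) \<le> \<bar>y i\<bar> * (sqrt (real t) * ?\<delta> * ?Y)"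
      by (rule mult_left_mono) simp
    then show ?thesis by (simp add: sum_distrib_left mult_ac)
  qed
  have "(\<Sum>i\<in>T. \<Sum>j\<in>T - {i}. ?g i j * (\<bar>y i\<bar> * \<bar>y j\<bar>))
      \<le> (\<Sum>i\<in>T. \<bar>y i\<bar>) * (sqrt (real t) * ?\<delta> * ?Y)"
    unfolding sum_distrib_right by (intro sum_mono inner)
  \<comment> \<open>The sum over at most \<open>t * s\<close> indices costs this root; together with
    the \<open>sqrt (real t)\<close> from the rows it makes up \<open>t * sqrt s\<close>.\<close>
  also have "\<dots> \<le> (sqrt (real (t * s)) * ?Y) * (sqrt (real t) * ?\<delta> * ?Y)"
  proof (rule mult_right_mono)
    have "(\<Sum>i\<in>T. \<bar>y i\<bar>) \<le> L2_set (\<lambda>_. 1) T * ?Y"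
      using L2_set_mult_ineq[of "\<lambda>_. 1" y T] by simp
    also have "L2_set (\<lambda>_. 1) T \<le> sqrt (real (t * s))"
      using T by (simp add: L2_set_def flip: of_nat_mult)
    finally show "(\<Sum>i\<in>T. \<bar>y i\<bar>) \<le> sqrt (real (t * s)) * ?Y"
      by (simp add: mult_right_mono)
  qed (simp add: rip_const_nonneg)
  also have "\<dots> = (sqrt (real t))\<^sup>2 * sqrt (real s) * ?\<delta> * ?Y\<^sup>2"
    by (simp add: real_sqrt_mult power2_eq_square mult_ac)
  also have "\<dots> = real t * sqrt (real s) * ?\<delta> * (\<Sum>i\<in>T. (y i)\<^sup>2)"
    by (simp add: L2_set_def sum_nonneg)
  finally show ?thesis .
qed

section \<open>Block coherence\<close>

lemma Sup0_upper: "x \<in> S \<Longrightarrow> bdd_above S \<Longrightarrow> x \<le> Sup0 S"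
  by (auto simp: Sup0_def intro: cSup_upper)

text \<open>Includes the empty set, which occurs in the coherence when there is only one
  block.\<close>

lemma Sup0_nonneg:
  assumes "\<And>x. x \<in> S \<Longrightarrow> 0 \<le> x" "bdd_above S"
  shows "0 \<le> Sup0 S"
proof (cases "S = {}")
  case False
  then obtain x where "x \<in> S" by blast
  then show ?thesis using assms Sup0_upper order_trans by blast
qed (simp add: Sup0_def)

lemma sparse_scaleR: "sparse k v \<Longrightarrow> sparse k (c *\<^sub>R (v::'a::real_normed_vector^'n))"
  unfolding sparse_def by (rule order_trans[OF card_mono]) auto

lemma sparse_mono: "sparse k v \<Longrightarrow> k \<le> l \<Longrightarrow> sparse l v"
  by (simp add: sparse_def)

lemma field_inner_scaleR:
  "field_inner (c *\<^sub>R u) v = of_real c * field_inner u v"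
  "field_inner u (c *\<^sub>R v) = of_real c * field_inner u v"
proof -
  have *: "c *\<^sub>R w = of_real c *s w" for w :: "'a^'n"
    by (simp add: vec_eq_iff scaleR_conv_of_real[where 'a = 'a])
  show "field_inner (c *\<^sub>R u) v = of_real c * field_inner u v"
    "field_inner u (c *\<^sub>R v) = of_real c * field_inner u v"
    by (simp_all add: * field_inner_scale_left field_inner_scale_right)
qed

text \<open>A value is below its supremum only for sets bounded above, so boundedness is shown for
  both nested suprema. The estimate for arbitrary sparse vectors then follows from the one for unit
  vectors by homogeneity.\<close>

lemma block_coherence_bounds:
  fixes B :: "'N::finite \<Rightarrow> 'a::conjugation^'n^'m"
  shows block_coherence_nonneg: "0 \<le> block_coherence k l (block_op B)"
    and block_coherence_upper: "i \<noteq> j \<Longrightarrow> sparse k u \<Longrightarrow> sparse l v \<Longrightarrow>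
      norm (field_inner (B i *v u) (B j *v v)) \<le> block_coherence k l (block_op B) * (norm u * norm v)"
proof -
  define C where "C = (\<lambda>i j. {norm (field_inner u ((conj_transpose (B i) ** B j) *v v)) | u v.
      sparse k u \<and> sparse l v \<and> norm u = 1 \<and> norm v = 1})"
  have mu: "block_coherence k l (block_op B) = Sup0 {Sup0 (C i j) | i j. i \<noteq> j}"
    by (simp add: block_coherence_def block_block_op C_def)
  have bdd: "bdd_above (C i j)" for i j
  proof (rule bdd_aboveI)
    fix x assume "x \<in> C i j"
    then obtain u v where uv: "norm u = 1" "norm v = 1"
      and x: "x = norm (field_inner u ((conj_transpose (B i) ** B j) *v v))"
      by (auto simp: C_def)
    have "x \<le> norm ((conj_transpose (B i) ** B j) *v v)"
      using norm_field_inner_le[of u] uv x by fastforce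
    also have "\<dots> \<le> (\<Sum>p\<in>UNIV. \<Sum>q\<in>UNIV. norm ((conj_transpose (B i) ** B j) $ p $ q))"
      using norm_matrix_vector_mult_le[of "conj_transpose (B i) ** B j" v] uv by simp
    finally show "x \<le> (\<Sum>p\<in>UNIV. \<Sum>q\<in>UNIV. norm ((conj_transpose (B i) ** B j) $ p $ q))" .
  qed
  have nonneg: "0 \<le> Sup0 (C i j)" for i j
    by (rule Sup0_nonneg[OF _ bdd]) (auto simp: C_def)
  \<comment> \<open>There are finitely many pairs of blocks, so the outer set is finite.\<close>
  have "{Sup0 (C i j) | i j. i \<noteq> j} \<subseteq> (\<lambda>(i, j). Sup0 (C i j)) ` UNIV"
    by auto
  then have bdd': "bdd_above {Sup0 (C i j) | i j. i \<noteq> j}"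
    by (meson bdd_above_finite finite finite_imageI finite_subset)
  show mu0: "0 \<le> block_coherence k l (block_op B)"
    unfolding mu by (rule Sup0_nonneg[OF _ bdd']) (use nonneg in auto)
  show "norm (field_inner (B i *v u) (B j *v v)) \<le> block_coherence k l (block_op B) * (norm u * norm v)"
    if ij: "i \<noteq> j" and u: "sparse k u" and v: "sparse l v"
  \<comment> \<open>Zero vectors cannot be normalised, but both sides vanish for them.\<close>
  proof (cases "u = 0 \<or> v = 0")
    case True
    then show ?thesis by auto
  next
    case False
    let ?u = "(1 / norm u) *\<^sub>R u" and ?v = "(1 / norm v) *\<^sub>R v"
    let ?f = "\<lambda>u v. norm (field_inner u ((conj_transpose (B i) ** B j) *v v))"
    have "?f ?u ?v \<in> C i j"
      unfolding C_def using False u v by (fastforce simp: sparse_scaleR)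
    then have "?f ?u ?v \<le> Sup0 (C i j)"
      by (rule Sup0_upper[OF _ bdd])
    also have "\<dots> \<le> block_coherence k l (block_op B)"
      unfolding mu by (rule Sup0_upper[OF _ bdd']) (use ij in auto)
    finally have *: "?f ?u ?v \<le> block_coherence k l (block_op B)" .
    have f: "?f u v = norm (field_inner (B i *v u) (B j *v v))" for u v
      by (simp add: field_inner_adjoint flip: matrix_vector_mul_assoc)
    have "B *v (c *\<^sub>R v) = c *\<^sub>R (B *v v)" for B :: "'a^'n^'m" and c v
      by (simp add: vec_eq_iff matrix_vector_mult_def scaleR_sum_right)
    then have "?f ?u ?v = ?f u v / (norm u * norm v)"
      unfolding f by (simp add: field_inner_scaleR norm_mult norm_divide)
    with * False show ?thesis
      unfolding f by (simp add: pos_divide_le_eq)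
  qed
qed

section \<open>The hierarchical measurement operator\<close>

lemma norm_tensor_vec: "norm (tensor_vec a y) = norm (a :: 'a::real_normed_field^'M) * norm y"
  unfolding tensor_vec_def norm_vec_def[of "\<chi> p. a $ p *s y"]
  by (simp add: norm_vector_smult) (simp add: norm_vec_def[of a] L2_set_left_distrib)

text \<open>Needed so that \<open>isometry_const_least\<close> applies to
  \<open>hier_op A B\<close>; the value of the constant is irrelevant.\<close>

lemma hier_op_bounded:
  fixes A :: "'a::real_normed_field^'N^'M" and B :: "'N \<Rightarrow> 'a^'n^'m"
  shows "\<exists>C. \<forall>x. norm (hier_op A B x) \<le> C * norm x"
proof (intro exI allI)
  let ?b = "\<lambda>i. \<Sum>p\<in>UNIV. \<Sum>q\<in>UNIV. norm (B i $ p $ q)"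
  fix x
  have "norm (hier_op A B x) \<le> (\<Sum>i\<in>UNIV. norm (column i A) * norm (B i *v (x $ i)))"
    unfolding hier_op_def by (rule order_trans[OF norm_sum]) (simp add: norm_tensor_vec)
  also have "\<dots> \<le> (\<Sum>i\<in>UNIV. norm (column i A) * (?b i * norm x))"
    by (intro sum_mono mult_left_mono order_trans[OF norm_matrix_vector_mult_le]
        Finite_Cartesian_Product.norm_nth_le sum_nonneg) auto
  finally show "norm (hier_op A B x) \<le> (\<Sum>i\<in>UNIV. norm (column i A) * ?b i) * norm x"
    by (simp only: sum_distrib_right mult.assoc)
qed

text \<open>Block \<open>p\<close> of the image is the combination of the
  \<open>B i *v (x $ i)\<close> with coefficients from row \<open>p\<close> of \<open>A\<close>.
  Expanding its square and summing over \<open>p\<close> first collects the coefficients into Gram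
  entries. The identity lives in the field, since single terms need not be real.\<close>

lemma norm_hier_op_square:
  fixes A :: "'a::conjugation^'N^'M" and B :: "'N \<Rightarrow> 'a^'n^'m"
  shows "of_real ((norm (hier_op A B x))\<^sup>2) = (\<Sum>i\<in>UNIV. \<Sum>j\<in>UNIV.
     field_inner (column i A) (column j A) * field_inner (B i *v (x $ i)) (B j *v (x $ j)))"
proof -
  let ?y = "\<lambda>i. B i *v (x $ i)"
  have gram: "field_inner (column i A) (column j A) = (\<Sum>p\<in>UNIV. conjugate (A $ p $ i) * A $ p $ j)" for i j
    by (simp add: field_inner_def column_def)
  have row: "hier_op A B x $ p = (\<Sum>i\<in>UNIV. A $ p $ i *s ?y i)" for p
    by (simp add: hier_op_def tensor_vec_def column_def)
  have "of_real ((norm (hier_op A B x))\<^sup>2)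
      = (\<Sum>p\<in>UNIV. field_inner (hier_op A B x $ p) (hier_op A B x $ p))"
    by (simp add: norm_vec_square[of "hier_op A B x"] field_inner_self)
  also have "\<dots> = (\<Sum>p\<in>UNIV. \<Sum>i\<in>UNIV. \<Sum>j\<in>UNIV.
      conjugate (A $ p $ i) * A $ p $ j * field_inner (?y i) (?y j))"
    unfolding row field_inner_sum_left
    unfolding field_inner_sum_right field_inner_scale_left field_inner_scale_right
    by (simp add: mult_ac)
  also have "\<dots> = (\<Sum>i\<in>UNIV. \<Sum>j\<in>UNIV. \<Sum>p\<in>UNIV.
      conjugate (A $ p $ i) * A $ p $ j * field_inner (?y i) (?y j))"
    by (subst sum.swap) (intro sum.cong refl sum.swap)
  also have "\<dots> = (\<Sum>i\<in>UNIV. \<Sum>j\<in>UNIV.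
      field_inner (column i A) (column j A) * field_inner (?y i) (?y j))"
    by (simp add: gram sum_distrib_right)
  finally show ?thesis .
qed

lemma hier_sparse_nth: "hier_sparse k \<sigma> x \<Longrightarrow> sparse \<sigma> (x $ i)"
  by (cases "x $ i = 0") (auto simp: hier_sparse_def sparse_def)

lemma hier_op_offdiagonal_le:
  fixes A :: "'a::conjugation^'N^'M" and B :: "'N \<Rightarrow> 'a^'n^'m"
  assumes "s > 0" and x: "hier_sparse (t * s) \<sigma> x"
  shows "\<bar>(norm (hier_op A B x))\<^sup>2 - (\<Sum>i\<in>UNIV. (norm (column i A))\<^sup>2 * (norm (B i *v (x $ i)))\<^sup>2)\<bar>
    \<le> real t * sqrt (real s) * rip_const (2 * s) A
        * block_coherence (2 * \<sigma>) (2 * \<sigma>) (block_op B) * (norm x)\<^sup>2"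
proof -
  let ?y = "\<lambda>i. B i *v (x $ i)"
  let ?a = "\<lambda>i j. field_inner (column i A) (column j A)"
  let ?\<mu> = "block_coherence (2 * \<sigma>) (2 * \<sigma>) (block_op B)"
  define T where "T = {i. x $ i \<noteq> 0}"
  have T: "card T \<le> t * s"
    using x by (simp add: hier_sparse_def T_def)
  \<comment> \<open>Brings the \<sigma>-sparse blocks to the level at which the coherence is
    taken.\<close>
  have sp: "sparse (2 * \<sigma>) (x $ i)" for i
  proof (rule sparse_mono)
    show "sparse \<sigma> (x $ i)" by (rule hier_sparse_nth[OF x])
  qed simp
  let ?F = "\<lambda>i j. ?a i j * field_inner (?y i) (?y j)"
  have "(\<Sum>i\<in>UNIV. \<Sum>j\<in>UNIV. ?F i j) = (\<Sum>i\<in>UNIV. ?F i i + (\<Sum>j\<in>UNIV - {i}. ?F i j))"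
    by (intro sum.cong refl sum.remove) auto
  then have *: "of_real ((norm (hier_op A B x))\<^sup>2 - (\<Sum>i\<in>UNIV. (norm (column i A))\<^sup>2 * (norm (?y i))\<^sup>2))
      = (\<Sum>i\<in>UNIV. \<Sum>j\<in>UNIV - {i}. ?F i j)"
    unfolding of_real_diff norm_hier_op_square by (simp add: field_inner_self sum.distrib)
  then have "\<bar>(norm (hier_op A B x))\<^sup>2 - (\<Sum>i\<in>UNIV. (norm (column i A))\<^sup>2 * (norm (?y i))\<^sup>2)\<bar>
      = norm (\<Sum>i\<in>UNIV. \<Sum>j\<in>UNIV - {i}. ?F i j)"
    by (simp only: norm_of_real flip: *)
  also have "\<dots> \<le> (\<Sum>i\<in>UNIV. \<Sum>j\<in>UNIV - {i}. norm (?F i j))"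
    by (intro order_trans[OF norm_sum] sum_mono norm_sum)
  also have "\<dots> \<le> (\<Sum>i\<in>UNIV. \<Sum>j\<in>UNIV - {i}.
      ?\<mu> * (norm (?a i j) * (\<bar>norm (x $ i)\<bar> * \<bar>norm (x $ j)\<bar>)))"
  proof (intro sum_mono)
    fix i j :: 'N assume "j \<in> UNIV - {i}"
    then have "norm (field_inner (?y i) (?y j)) \<le> ?\<mu> * (norm (x $ i) * norm (x $ j))"
      by (intro block_coherence_upper sp) auto
    then have "norm (?a i j) * norm (field_inner (?y i) (?y j))
        \<le> norm (?a i j) * (?\<mu> * (norm (x $ i) * norm (x $ j)))"
      by (rule mult_left_mono) simp
    then show "norm (?F i j) \<le> ?\<mu> * (norm (?a i j) * (\<bar>norm (x $ i)\<bar> * \<bar>norm (x $ j)\<bar>))"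
      by (simp add: norm_mult mult_ac)
  qed
  also have "\<dots> = ?\<mu> * (\<Sum>i\<in>UNIV. \<Sum>j\<in>UNIV - {i}. norm (?a i j) * (\<bar>norm (x $ i)\<bar> * \<bar>norm (x $ j)\<bar>))"
    by (simp add: sum_distrib_left)
  \<comment> \<open>Zero blocks contribute nothing, so both sums shrink to the support
    \<open>T\<close>, whose size is controlled by \<open>T\<close>.\<close>
  also have "(\<Sum>i\<in>UNIV. \<Sum>j\<in>UNIV - {i}. norm (?a i j) * (\<bar>norm (x $ i)\<bar> * \<bar>norm (x $ j)\<bar>))
      = (\<Sum>i\<in>T. \<Sum>j\<in>UNIV - {i}. norm (?a i j) * (\<bar>norm (x $ i)\<bar> * \<bar>norm (x $ j)\<bar>))"
    by (rule sum.mono_neutral_right) (auto simp: T_def)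
  also have "\<dots> = (\<Sum>i\<in>T. \<Sum>j\<in>T - {i}. norm (?a i j) * (\<bar>norm (x $ i)\<bar> * \<bar>norm (x $ j)\<bar>))"
    by (intro sum.cong refl sum.mono_neutral_right) (auto simp: T_def)
  also have "?\<mu> * \<dots> \<le> ?\<mu> * (real t * sqrt (real s) * rip_const (2 * s) A * (\<Sum>i\<in>T. (norm (x $ i))\<^sup>2))"
    by (intro mult_left_mono gram_offdiagonal_form_le assms T block_coherence_nonneg)
  also have "(\<Sum>i\<in>T. (norm (x $ i))\<^sup>2) = (norm x)\<^sup>2"
    unfolding norm_vec_square[of x] by (rule sum.mono_neutral_left) (auto simp: T_def)
  finally show ?thesis by (simp add: mult_ac)
qed

text \<open>With \<alpha> for \<open>rip_const s A\<close>, the upper factors multiply to (1 +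
  \<alpha>)(1 + \<beta>) = 1 + \<epsilon>, and the lower ones to (1 - \<alpha>)(1 - \<beta>) \<ge> 1
  - \<epsilon>.\<close>

lemma hier_op_diagonal_bounds:
  fixes A :: "'a::real_normed_field^'N^'M" and B :: "'N \<Rightarrow> 'a^'n^'m"
  assumes "s > 0" and x: "hier_sparse k \<sigma> x" and \<beta>: "\<And>i. rip_const \<sigma> (B i) \<le> \<beta>"
  defines "\<epsilon> \<equiv> rip_const s A + \<beta> + rip_const s A * \<beta>"
  shows "(1 - \<epsilon>) * (norm x)\<^sup>2
      \<le> (\<Sum>i\<in>UNIV. (norm (column i A))\<^sup>2 * (norm (B i *v (x $ i)))\<^sup>2)" (is ?lower)
    and "(\<Sum>i\<in>UNIV. (norm (column i A))\<^sup>2 * (norm (B i *v (x $ i)))\<^sup>2)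
      \<le> (1 + \<epsilon>) * (norm x)\<^sup>2" (is ?upper)
proof -
  let ?\<alpha> = "rip_const s A"
  have \<alpha>0: "0 \<le> ?\<alpha>" by (rule rip_const_nonneg)
  have \<beta>0: "0 \<le> \<beta>" using rip_const_nonneg \<beta> order_trans by blast
  have "(1 - \<epsilon>) * (norm (x $ i))\<^sup>2 \<le> (norm (column i A))\<^sup>2 * (norm (B i *v (x $ i)))\<^sup>2 \<and>
      (norm (column i A))\<^sup>2 * (norm (B i *v (x $ i)))\<^sup>2 \<le> (1 + \<epsilon>) * (norm (x $ i))\<^sup>2" for i
  proof
    let ?a = "(norm (column i A))\<^sup>2" and ?b = "(norm (B i *v (x $ i)))\<^sup>2" and ?r = "(norm (x $ i))\<^sup>2"
    have sp: "sparse \<sigma> (x $ i)"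
      by (rule hier_sparse_nth[OF x])
    note a = norm_column_rip[OF \<open>s > 0\<close>, where A = A and i = i]
    have "(1 - \<beta>) * ?r \<le> (1 - rip_const \<sigma> (B i)) * ?r"
      using \<beta>[of i] by (intro mult_right_mono) auto
    then have b1: "(1 - \<beta>) * ?r \<le> ?b"
      using rip_const_lower[OF sp, of "B i"] by linarith
    have "(1 + rip_const \<sigma> (B i)) * ?r \<le> (1 + \<beta>) * ?r"
      using \<beta>[of i] by (intro mult_right_mono) auto
    then have b2: "?b \<le> (1 + \<beta>) * ?r"
      using rip_const_upper[OF sp, of "B i"] by linarith
    have "?a * ?b \<le> (1 + ?\<alpha>) * ((1 + \<beta>) * ?r)"
      using a b2 \<alpha>0 by (intro mult_mono) auto
    also have "\<dots> = (1 + \<epsilon>) * ?r"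
      by (simp add: \<epsilon>_def algebra_simps)
    finally show "?a * ?b \<le> (1 + \<epsilon>) * ?r" .
    show "(1 - \<epsilon>) * ?r \<le> ?a * ?b"
    \<comment> \<open>Lower bounds may be multiplied when the factors are nonnegative. If \<alpha>
      or \<beta> exceeds 1, then so does \<epsilon>, and the left-hand side is at most 0.\<close>
    proof (cases "?\<alpha> \<le> 1 \<and> \<beta> \<le> 1")
      case True
      have "1 - \<epsilon> \<le> (1 - ?\<alpha>) * (1 - \<beta>)"
        using \<alpha>0 \<beta>0 by (simp add: \<epsilon>_def algebra_simps)
      then have "(1 - \<epsilon>) * ?r \<le> (1 - ?\<alpha>) * (1 - \<beta>) * ?r"
        by (intro mult_right_mono) auto
      also have "\<dots> = (1 - ?\<alpha>) * ((1 - \<beta>) * ?r)"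
        by simp
      also have "\<dots> \<le> ?a * ?b"
        using True a b1 by (intro mult_mono) auto
      finally show ?thesis .
    next
      case False
      then have "1 - \<epsilon> \<le> 0"
        using \<alpha>0 \<beta>0 mult_nonneg_nonneg[OF \<alpha>0 \<beta>0] unfolding \<epsilon>_def by linarith
      then have "(1 - \<epsilon>) * ?r \<le> 0"
        by (intro mult_nonpos_nonneg) auto
      also have "0 \<le> ?a * ?b" by simp
      finally show ?thesis .
    qed
  qed
  then show ?lower ?upper
    unfolding norm_vec_square[of x] sum_distrib_left by (auto intro: sum_mono)
qed

text \<open>Stated over \<open>conjugation\<close>, so that the real and the complex theorem are
  both instances. By minimality of the constant it suffices that the claimed bound is
  admissible.\<close>

lemma hier_rip_const_le:
  fixes A :: "'a::conjugation^'N^'M" and B :: "'N \<Rightarrow> 'a^'n^'m"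
  assumes "s > 0"
  shows "hier_rip_const (t * s) \<sigma> (hier_op A B)
      \<le> rip_const s A + (SUP i. rip_const \<sigma> (B i)) + rip_const s A * (SUP i. rip_const \<sigma> (B i))
        + real t * sqrt (real s) * rip_const (2 * s) A
          * block_coherence (2 * \<sigma>) (2 * \<sigma>) (block_op B)" (is "_ \<le> ?\<epsilon> + ?\<eta>")
proof -
  have sup: "rip_const \<sigma> (B i) \<le> (SUP i. rip_const \<sigma> (B i))" for i
    by (intro cSUP_upper) auto
  then have sup0: "0 \<le> (SUP i. rip_const \<sigma> (B i))"
    using rip_const_nonneg order_trans by blast
  obtain C where C: "\<And>x. norm (hier_op A B x) \<le> C * norm x"
    using hier_op_bounded by blast
  show ?thesis
    unfolding hier_rip_const_def
  proof (rule isometry_const_least(2)[OF C], intro conjI ballI)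
    show "0 \<le> ?\<epsilon> + ?\<eta>"
      using sup0 by (simp add: rip_const_nonneg block_coherence_nonneg)
  next
    fix x :: "'a^'n^'N" assume "x \<in> {x. hier_sparse (t * s) \<sigma> x}"
    then have x: "hier_sparse (t * s) \<sigma> x" by simp
    \<comment> \<open>The diagonal accounts for \<open>?\<epsilon>\<close> and the off-diagonal
      terms for \<open>?\<eta>\<close>, each times \<open>(norm x)\<^sup>2\<close>.\<close>
    note bounds = hier_op_diagonal_bounds[where A = A and B = B, OF assms x sup]
      hier_op_offdiagonal_le[OF assms x, of A B]
    show "(1 - (?\<epsilon> + ?\<eta>)) * (norm x)\<^sup>2 \<le> (norm (hier_op A B x))\<^sup>2"
      and "(norm (hier_op A B x))\<^sup>2 \<le> (1 + (?\<epsilon> + ?\<eta>)) * (norm x)\<^sup>2"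
      using bounds unfolding left_diff_distrib distrib_right by linarith+
  qed
qed

theorem theorem5:
  fixes s \<sigma> t :: nat
  assumes "s > 0" and "\<sigma> > 0" and "t > 0"
  shows
   "(\<forall>(A :: real^'N^'M) (B :: 'N \<Rightarrow> real^'n^'m).
       hier_rip_const (t * s) \<sigma> (hier_op A B)
         \<le> rip_const s A + (SUP i. rip_const \<sigma> (B i)) + rip_const s A * (SUP i. rip_const \<sigma> (B i))
           + real t * sqrt (real s) * rip_const (2 * s) A
             * block_coherence (2 * \<sigma>) (2 * \<sigma>) (block_op B)) \<and>
    (\<forall>(A :: complex^'N^'M) (B :: 'N \<Rightarrow> complex^'n^'m).
       hier_rip_const (t * s) \<sigma> (hier_op A B)
         \<le> rip_const s A + (SUP i. rip_const \<sigma> (B i)) + rip_const s A * (SUP i. rip_const \<sigma> (B i))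
           + real t * sqrt (real s) * rip_const (2 * s) A
             * block_coherence (2 * \<sigma>) (2 * \<sigma>) (block_op B))"
  by (intro conjI allI hier_rip_const_le assms(1))

end
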